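(* Let $m$ be an odd positive integer and $a$ a nonzero integer such that $a\notin\mathbb{Q}^q$ for every prime $q\mid m$, and such that for every prime $q\mid m$ either $q\nmid v_q(a)$ or $q^{v_q(m)}\mid v_q(a)$. Let $p$ be a prime with $p\nmid m$. Then the ramification index of $p$ in $\mathbb{Q}(\zeta_m,\sqrt[m]{a})/\mathbb{Q}$ equals $\dfrac{m}{(m,v_p(a))}$; in particular $p$ is tamely ramified.
   Context: $\zeta_m$ is a primitive $m$-th root of unity, $\sqrt[m]{a}$ a root of $x^m-a$, $v_p$ the $p$-adic valuation, and $(m,v_p(a))$ the gcd (with $(m,0)=m$). *)

theory Defs
  imports
    "HOL-Algebra.Algebraic_Closure_Type"
    "HOL-Algebra.Generated_Fields"
    "HOL-Algebra.Ideal_Product"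
    "HOL-Computational_Algebra.Computational_Algebra"
begin

definition primitive_root_of_unity :: "nat \<Rightarrow> complex \<Rightarrow> bool" where
  "primitive_root_of_unity m \<zeta> \<longleftrightarrow> \<zeta> ^ m = 1 \<and> (\<forall>k. 0 < k \<and> k < m \<longrightarrow> \<zeta> ^ k \<noteq> 1)"

text \<open>
  Number fields are subfields of the complex numbers, given by their underlying sets.
  The subfield generated by \<open>S\<close> contains the rational numbers, so this is \<open>\<rat>(S)\<close>.
\<close>

definition rat_adjoin :: "complex set \<Rightarrow> complex set" where
  "rat_adjoin S = generate_field ring_of_type_algebra S"

definition ring_of_integers :: "complex set \<Rightarrow> complex ring" where
  "ring_of_integers K = ring_of_type_algebra \<lparr> carrier := {x \<in> K. algebraic_int x} \<rparr>"

definition primes_over :: "complex set \<Rightarrow> nat \<Rightarrow> complex set set" where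
  "primes_over K p =
     {P. primeideal P (ring_of_integers K) \<and> P \<inter> \<int> = {of_int (int p * k) |k. True}}"

text \<open>
  \<open>e(P|p)\<close>, the exponent of \<open>P\<close> in the factorisation of the ideal generated by \<open>p\<close>:
  in a Dedekind domain \<open>P\<^sup>e\<close> divides an ideal iff it contains it. In \<open>ideals_set\<close>
  the multiplication is the product of ideals and the unit is the whole ring.
\<close>

definition prime_ramification_index :: "complex set \<Rightarrow> nat \<Rightarrow> complex set \<Rightarrow> nat" where
  "prime_ramification_index K p P =
     (GREATEST e::nat. PIdl\<^bsub>ring_of_integers K\<^esub> (of_nat p)
                         \<subseteq> P [^]\<^bsub>ideals_set (ring_of_integers K)\<^esub> e)"

text \<open>
  For \<open>K\<close> Galois over \<open>\<rat>\<close>, the ramification index of \<open>p\<close> in \<open>K\<close> is the common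
  value of \<open>e(P|p)\<close> at the primes \<open>P\<close> over \<open>p\<close>. Equality with a singleton also
  says that such primes exist.
\<close>

definition has_ramification_index :: "complex set \<Rightarrow> nat \<Rightarrow> nat \<Rightarrow> bool" where
  "has_ramification_index K p e \<longleftrightarrow> prime_ramification_index K p ` primes_over K p = {e}"

text \<open>
  Residue fields of number fields are finite, so separability of the residue
  extensions is automatic. Unramified primes count as tamely ramified.
\<close>

definition tamely_ramified :: "complex set \<Rightarrow> nat \<Rightarrow> bool" where
  "tamely_ramified K p \<longleftrightarrow> (\<forall>P \<in> primes_over K p. \<not> p dvd prime_ramification_index K p P)"

end

(*
  Let v = v_p(a), g = gcd(m, v), n = m/g, w = v/g, and choose x, y with w x + n = 1 + n y.
  Then beta = alpha^n / p^w satisfies beta^g = u with u = a / p^v an integer prime to p, and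
  pi = alpha^x p / p^y satisfies pi^n = p beta^x, so that pi^n is p up to an algebraic integer
  which is a unit at p. It remains to see that pi is a uniformiser at every prime P over p.
  For a power q of p with m (p - 1) | q - 1, the map z |-> z^q is the identity modulo pi on
  zeta, beta, pi and on the rationals prime to p, hence on the ring A that they generate. Thus
  A/pi is reduced, which forces A to contain all algebraic integers of the field. If z lies
  in P, then z^q - z = z (z^(q-1) - 1) is divisible by pi, up to a denominator prime to p, while
  z^(q-1) - 1 is a unit at P, so P is generated by pi locally at P.
*)

theory Submission
  imports Defs "HOL-Number_Theory.Residues" "Jordan_Normal_Form.Char_Poly"
begin

section \<open>Algebraic integers form a ring\<close>

text \<open>The additive group generated by \<open>B\<close>, meant for finite \<open>B\<close>:
  over an infinite set the sum is 0 by convention. Coefficients are indexed by the elements of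
  \<open>B\<close> themselves.\<close>

definition int_span :: "'a::field_char_0 set \<Rightarrow> 'a set" where
  "int_span B = range (\<lambda>c :: 'a \<Rightarrow> int. \<Sum>b\<in>B. of_int (c b) * b)"

lemma int_span_add: "x \<in> int_span B \<Longrightarrow> y \<in> int_span B \<Longrightarrow> x + y \<in> int_span B"
proof -
  assume "x \<in> int_span B" "y \<in> int_span B"
  then obtain c d where "x = (\<Sum>b\<in>B. of_int (c b) * b)" "y = (\<Sum>b\<in>B. of_int (d b) * b)"
    by (auto simp: int_span_def)
  hence "x + y = (\<Sum>b\<in>B. of_int (c b + d b) * b)"
    by (simp add: sum.distrib algebra_simps)
  thus ?thesis unfolding int_span_def by (rule range_eqI[of _ _ "\<lambda>b. c b + d b"])
qed

lemma int_span_of_int_mult: "x \<in> int_span B \<Longrightarrow> of_int k * x \<in> int_span B"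
proof -
  assume "x \<in> int_span B"
  then obtain c where "x = (\<Sum>b\<in>B. of_int (c b) * b)"
    by (auto simp: int_span_def)
  hence "of_int k * x = (\<Sum>b\<in>B. of_int (k * c b) * b)"
    by (simp add: sum_distrib_left algebra_simps)
  thus ?thesis unfolding int_span_def by (rule range_eqI[of _ _ "\<lambda>b. k * c b"])
qed

lemma int_span_0: "0 \<in> int_span B"
  unfolding int_span_def by (rule range_eqI[of _ _ "\<lambda>_. 0"]) simp

lemma int_span_sum: "(\<And>i. i \<in> I \<Longrightarrow> f i \<in> int_span B) \<Longrightarrow> sum f I \<in> int_span B"
  by (induction I rule: infinite_finite_induct) (auto simp: int_span_0 int_span_add)

lemma int_span_base:
  assumes "finite B" "b \<in> B"
  shows "b \<in> int_span B"
  unfolding int_span_def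
proof (rule range_eqI[of _ _ "\<lambda>x. if x = b then 1 else 0"])
  have "(\<Sum>x\<in>B. of_int (if x = b then 1 else 0) * x) = (\<Sum>x\<in>B. if x = b then b else 0)"
    by (rule sum.cong) auto
  thus "b = (\<Sum>x\<in>B. of_int (if x = b then 1 else 0) * x)" using assms by simp
qed

lemma int_span_mult_closed:
  assumes "\<And>b. b \<in> B \<Longrightarrow> z * b \<in> int_span B" and "x \<in> int_span B"
  shows "z * x \<in> int_span B"
proof -
  obtain c where x: "x = (\<Sum>b\<in>B. of_int (c b) * b)"
    using assms(2) by (auto simp: int_span_def)
  have "z * x = (\<Sum>b\<in>B. of_int (c b) * (z * b))"
    by (simp add: x sum_distrib_left algebra_simps)
  thus ?thesis using assms(1) by (auto intro!: int_span_sum int_span_of_int_mult)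
qed

text \<open>An element stabilising a finitely generated nonzero group is an eigenvalue of an integer matrix.\<close>

lemma algebraic_int_if_stabilises_int_span:
  fixes z :: "'a::field_char_0"
  assumes B: "finite B" "1 \<in> B" and z: "\<And>b. b \<in> B \<Longrightarrow> z * b \<in> int_span B"
  shows "algebraic_int z"
proof -
  define n where "n = card B"
  obtain f where f: "bij_betw f {0..<n} B"
    using ex_bij_betw_nat_finite[OF B(1)] n_def by blast
  have "\<exists>c. z * b = (\<Sum>b'\<in>B. of_int (c b') * b')" if "b \<in> B" for b
    using z[OF that] by (auto simp: int_span_def)
  then obtain c :: "'a \<Rightarrow> 'a \<Rightarrow> int"
    where c: "\<And>b. b \<in> B \<Longrightarrow> z * b = (\<Sum>b'\<in>B. of_int (c b b') * b')"
    by metis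
  \<comment> \<open>\<open>M\<close> is the matrix of multiplication by \<open>z\<close> on the
    generators, and \<open>v\<close> lists these generators, so \<open>v\<close> is an eigenvector
    for \<open>z\<close>. It is nonzero because 1 is a generator. The characteristic polynomial of
    \<open>M\<close> is then a monic integer polynomial that vanishes at \<open>z\<close>.\<close>
  define M :: "int mat" where "M = mat n n (\<lambda>(i, j). c (f i) (f j))"
  define N :: "'a mat" where "N = map_mat of_int M"
  define v where "v = vec n f"
  have M: "M \<in> carrier_mat n n" and N: "N \<in> carrier_mat n n"
    by (simp_all add: M_def N_def)
  have "N *\<^sub>v v = z \<cdot>\<^sub>v v"
  proof (rule eq_vecI)
    fix i assume "i < dim_vec (z \<cdot>\<^sub>v v)"
    hence i: "i < n" by (simp add: v_def)
    hence "f i \<in> B" using f by (auto simp: bij_betw_def)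
    have "(N *\<^sub>v v) $ i = (\<Sum>j\<in>{0..<n}. of_int (c (f i) (f j)) * f j)"
      using i by (simp add: N_def M_def v_def mult_mat_vec_def scalar_prod_def)
    also have "\<dots> = (\<Sum>b\<in>B. of_int (c (f i) b) * b)"
      by (rule sum.reindex_bij_betw[OF f])
    finally show "(N *\<^sub>v v) $ i = (z \<cdot>\<^sub>v v) $ i"
      using c[OF \<open>f i \<in> B\<close>] i by (simp add: v_def)
  qed (simp_all add: N_def M_def v_def)
  moreover have "v \<noteq> 0\<^sub>v n"
  proof
    assume v0: "v = 0\<^sub>v n"
    obtain i where "i < n" "f i = 1" using B(2) f by (auto simp: bij_betw_def image_iff)
    thus False using arg_cong[OF v0, of "\<lambda>v. vec_index v i"] by (simp add: v_def)
  qed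
  ultimately have "eigenvector N v z"
    using N by (simp add: eigenvector_def v_def)
  hence "poly (char_poly N) z = 0"
    using eigenvalue_root_char_poly[OF N] by (auto simp: eigenvalue_def)
  moreover have "char_poly N = map_poly of_int (char_poly M)"
    unfolding N_def by (rule of_int_hom.char_poly_hom[OF M])
  moreover have "lead_coeff (char_poly M) = 1"
    using degree_monic_char_poly[OF M] by simp
  ultimately show ?thesis by (auto simp: algebraic_int_altdef_ipoly)
qed

lemma algebraic_int_powers_int_span:
  fixes x :: "'a::field_char_0"
  assumes "algebraic_int x"
  obtains d c where "d > 0" and "x ^ d = (\<Sum>i<d. of_int (c i) * x ^ i)"
proof -
  obtain p where p: "poly (map_poly of_int p) x = 0" "lead_coeff p = 1"
    using assms by (auto simp: algebraic_int_altdef_ipoly)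
  define d where "d = degree p"
  have "d > 0"
  proof (rule ccontr)
    assume "\<not> d > 0"
    hence "p = [:1:]" using p(2) d_def by (metis degree_0_id gr0I monom_0 coeff_pCons_0 degree_eq_zeroE pCons_eq_0_iff)
    thus False using p(1) by simp
  qed
  have "0 = (\<Sum>i\<le>d. of_int (coeff p i) * x ^ i)"
    using p(1) by (simp add: poly_altdef d_def)
  also have "\<dots> = x ^ d + (\<Sum>i<d. of_int (coeff p i) * x ^ i)"
    using p(2) by (simp add: d_def lessThan_Suc_atMost[symmetric])
  finally have "x ^ d = (\<Sum>i<d. of_int (- coeff p i) * x ^ i)"
    by (simp add: sum_negf eq_neg_iff_add_eq_0)
  with \<open>d > 0\<close> show ?thesis using that[of d "\<lambda>i. - coeff p i"] by blast
qed

text \<open>The products \<open>x ^ i * y ^ j\<close> with exponents below the degrees of the monic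
  equations generate a group stable under both numbers: a multiplication raises one exponent, and a
  top power is rewritten by its equation. Sums and products of \<open>x\<close> and \<open>y\<close>
  then stabilise the same group.\<close>

lemma algebraic_int_common_int_span:
  fixes x y :: "'a::field_char_0"
  assumes "algebraic_int x" "algebraic_int y"
  obtains B where "finite B" "1 \<in> B" "\<And>b. b \<in> B \<Longrightarrow> x * b \<in> int_span B"
    "\<And>b. b \<in> B \<Longrightarrow> y * b \<in> int_span B"
proof -
  obtain d c where d: "d > 0" and c: "x ^ d = (\<Sum>i<d. of_int (c i) * x ^ i)"
    using algebraic_int_powers_int_span[OF assms(1)] .
  obtain e c' where e: "e > 0" and c': "y ^ e = (\<Sum>i<e. of_int (c' i) * y ^ i)"
    using algebraic_int_powers_int_span[OF assms(2)] .
  define B where "B = (\<lambda>(i, j). x ^ i * y ^ j) ` ({..<d} \<times> {..<e})"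
  have fin: "finite B" by (simp add: B_def)
  have mem: "x ^ i * y ^ j \<in> int_span B" if "i < d" "j < e" for i j
    using int_span_base[OF fin] that by (force simp: B_def)
  have "x * b \<in> int_span B" if "b \<in> B" for b
  proof -
    obtain i j where ij: "i < d" "j < e" "b = x ^ i * y ^ j" using \<open>b \<in> B\<close> by (auto simp: B_def)
    show ?thesis
    proof (cases "Suc i < d")
      case True
      thus ?thesis using mem[of "Suc i" j] ij by (simp add: mult_ac)
    next
      case False
      hence "d = Suc i" using ij by simp
      have "x * b = x ^ d * y ^ j" using ij \<open>d = Suc i\<close> by (simp add: mult_ac)
      also have "\<dots> = (\<Sum>i<d. of_int (c i) * (x ^ i * y ^ j))"
        unfolding c by (simp add: sum_distrib_left sum_distrib_right mult_ac)
      finally show ?thesis using mem ij by (auto intro!: int_span_sum int_span_of_int_mult)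
    qed
  qed
  moreover have "y * b \<in> int_span B" if "b \<in> B" for b
  proof -
    obtain i j where ij: "i < d" "j < e" "b = x ^ i * y ^ j" using \<open>b \<in> B\<close> by (auto simp: B_def)
    show ?thesis
    proof (cases "Suc j < e")
      case True
      thus ?thesis using mem[of i "Suc j"] ij by (simp add: mult_ac)
    next
      case False
      hence "e = Suc j" using ij by simp
      have "y * b = x ^ i * y ^ e" using ij \<open>e = Suc j\<close> by (simp add: mult_ac)
      also have "\<dots> = (\<Sum>j<e. of_int (c' j) * (x ^ i * y ^ j))"
        unfolding c' by (simp add: sum_distrib_left mult_ac)
      finally show ?thesis using mem ij by (auto intro!: int_span_sum int_span_of_int_mult)
    qed
  qed
  moreover have "1 \<in> B" unfolding B_def using d e by (intro image_eqI[of _ _ "(0,0)"]) auto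
  ultimately show ?thesis using that fin by blast
qed

lemma algebraic_int_add:
  fixes x y :: "'a::field_char_0"
  assumes "algebraic_int x" "algebraic_int y"
  shows "algebraic_int (x + y)"
proof -
  obtain B where B: "finite B" "1 \<in> B" "\<And>b. b \<in> B \<Longrightarrow> x * b \<in> int_span B"
    "\<And>b. b \<in> B \<Longrightarrow> y * b \<in> int_span B"
    using algebraic_int_common_int_span[OF assms] by blast
  show ?thesis
    by (rule algebraic_int_if_stabilises_int_span[OF B(1,2)])
       (simp add: distrib_right int_span_add B)
qed

lemma algebraic_int_mult:
  fixes x y :: "'a::field_char_0"
  assumes "algebraic_int x" "algebraic_int y"
  shows "algebraic_int (x * y)"
proof -
  obtain B where B: "finite B" "1 \<in> B" "\<And>b. b \<in> B \<Longrightarrow> x * b \<in> int_span B"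
    "\<And>b. b \<in> B \<Longrightarrow> y * b \<in> int_span B"
    using algebraic_int_common_int_span[OF assms] by blast
  show ?thesis
    by (rule algebraic_int_if_stabilises_int_span[OF B(1,2)])
       (simp add: mult.assoc int_span_mult_closed B)
qed

lemma algebraic_int_power:
  fixes x :: "'a::field_char_0"
  shows "algebraic_int x \<Longrightarrow> algebraic_int (x ^ n)"
  by (induction n) (auto intro: algebraic_int_mult)

lemma algebraic_int_if_power_algebraic_int:
  fixes x :: "'a::field_char_0"
  assumes "algebraic_int (x ^ n)" "n > 0"
  shows "algebraic_int x"
proof (rule algebraic_int_root[OF assms(1)])
  show "poly (monom 1 n) x = x ^ n" by (simp add: poly_monom)
qed (use assms in \<open>auto simp: degree_monom_eq\<close>)

section \<open>Ramification from a local uniformiser\<close>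

text \<open>Closure under inverses is left out, because the same facts serve for number fields, for
  the order in which the Frobenius congruence holds, and for auxiliary rings of fractions.\<close>

locale complex_subring =
  fixes K :: "complex set"
  assumes one: "1 \<in> K" and uminus: "x \<in> K \<Longrightarrow> - x \<in> K"
    and add: "x \<in> K \<Longrightarrow> y \<in> K \<Longrightarrow> x + y \<in> K"
    and mult: "x \<in> K \<Longrightarrow> y \<in> K \<Longrightarrow> x * y \<in> K"
begin

abbreviation "R \<equiv> ring_of_integers K"

section \<open>The ring of algebraic integers of a subring\<close>

lemma zero: "0 \<in> K"
  using add[OF one uminus[OF one]] by simp

lemma of_nat_mem: "of_nat k \<in> K"
  by (induction k) (auto intro: add one zero)

lemma of_int_mem: "of_int k \<in> K"
  by (cases k) (auto intro: of_nat_mem uminus simp del: of_nat_Suc)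

lemma carrier_R: "carrier R = {x \<in> K. algebraic_int x}"
  by (simp add: ring_of_integers_def)

lemma R_simps [simp]:
  "x \<otimes>\<^bsub>R\<^esub> y = x * y" "x \<oplus>\<^bsub>R\<^esub> y = x + y" "\<one>\<^bsub>R\<^esub> = 1" "\<zero>\<^bsub>R\<^esub> = 0"
  by (simp_all add: ring_of_integers_def ring_of_type_algebra_def)

lemma R_1: "1 \<in> carrier R" and R_0: "0 \<in> carrier R"
  and R_of_int: "of_int k \<in> carrier R"
  and R_of_nat: "of_nat j \<in> carrier R"
  and R_uminus: "x \<in> carrier R \<Longrightarrow> - x \<in> carrier R"
  and R_add: "x \<in> carrier R \<Longrightarrow> y \<in> carrier R \<Longrightarrow> x + y \<in> carrier R"
  and R_mult: "x \<in> carrier R \<Longrightarrow> y \<in> carrier R \<Longrightarrow> x * y \<in> carrier R"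
  by (auto simp: carrier_R one zero add mult uminus algebraic_int_add algebraic_int_mult
      of_int_mem of_nat_mem)

lemma R_power: "x \<in> carrier R \<Longrightarrow> x ^ n \<in> carrier R"
  by (induction n) (auto intro: R_1 R_mult)

lemma R_diff: "x \<in> carrier R \<Longrightarrow> y \<in> carrier R \<Longrightarrow> x - y \<in> carrier R"
  using R_add[of x "- y"] R_uminus[of y] by simp

lemma R_ints_iff: "x \<in> \<rat> \<Longrightarrow> x \<in> carrier R \<longleftrightarrow> x \<in> \<int>"
  by (auto simp: carrier_R rational_algebraic_int_is_int elim!: Ints_cases intro: of_int_mem)

sublocale cring R
proof (rule cringI)
  show "abelian_group R"
    by (rule abelian_groupI)
       (auto simp: R_add R_0 add_ac intro!: bexI[of _ "- x" for x] R_uminus)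
  show "comm_monoid R"
    by (rule comm_monoidI) (auto simp: R_mult R_1 mult_ac)
qed (auto simp: algebra_simps)

lemma ideal_add: "ideal I R \<Longrightarrow> x \<in> I \<Longrightarrow> y \<in> I \<Longrightarrow> x + y \<in> I"
  using additive_subgroup.a_closed[OF ideal.axioms(1), of I R x y] by simp

lemma ideal_mult: "ideal I R \<Longrightarrow> x \<in> I \<Longrightarrow> y \<in> carrier R \<Longrightarrow> y * x \<in> I"
  using ideal.I_l_closed[of I R x y] by simp

text \<open>Bezout's identity. With \<open>k\<close> and \<open>l\<close> coprime it strips integer
  multipliers from a member of an ideal.\<close>

lemma ideal_mem_gcd:
  assumes I: "ideal I R" and "x \<in> carrier R"
    and "of_int k * x \<in> I" "of_int l * x \<in> I"
  shows "of_int (gcd k l) * x \<in> I"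
proof -
  obtain u v where "u * k + v * l = gcd k l" using bezout_int by blast
  hence "of_int (gcd k l) * x = of_int u * (of_int k * x) + of_int v * (of_int l * x)"
    by (metis (no_types, lifting) distrib_right mult.assoc of_int_add of_int_mult)
  thus ?thesis using assms by (simp add: ideal_add ideal_mult R_of_int)
qed

section \<open>Existence of primes over p\<close>

text \<open>Krull's theorem, by Zorn's lemma on the ideals that contain \<open>I\<close> and avoid
  1.\<close>

lemma exists_maximalideal:
  assumes "ideal I R" "1 \<notin> I"
  obtains P where "maximalideal P R" "I \<subseteq> P"
proof -
  define \<A> where "\<A> = {J. ideal J R \<and> I \<subseteq> J \<and> 1 \<notin> J}"
  have "\<exists>M\<in>\<A>. \<forall>N\<in>\<A>. M \<subseteq> N \<longrightarrow> N = M"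
  proof (rule subset_Zorn_nonempty)
    show "\<A> \<noteq> {}" using assms by (auto simp: \<A>_def)
  next
    fix C assume C: "C \<noteq> {}" "subset.chain \<A> C"
    have "subset.chain {J. ideal J R} C"
      using C(2) by (auto simp: subset.chain_def \<A>_def)
    from chain_Union_is_ideal[OF this] have "ideal (\<Union>C) R" using C(1) by simp
    thus "\<Union>C \<in> \<A>" using C by (auto simp: \<A>_def subset.chain_def)
  qed
  then obtain P where P: "P \<in> \<A>" "\<And>J. J \<in> \<A> \<Longrightarrow> P \<subseteq> J \<Longrightarrow> J = P" by blast
  have "maximalideal P R"
  proof (rule maximalidealI)
    show "ideal P R" using P(1) by (simp add: \<A>_def)
    show "carrier R \<noteq> P" using P(1) R_1 by (auto simp: \<A>_def)
    fix J assume J: "ideal J R" "P \<subseteq> J" "J \<subseteq> carrier R"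
    show "J = P \<or> J = carrier R"
    proof (cases "1 \<in> J")
      case True
      thus ?thesis using ideal.one_imp_carrier[OF J(1)] by simp
    next
      case False
      hence "J \<in> \<A>" using J P(1) by (auto simp: \<A>_def)
      thus ?thesis using P(2) J(2) by blast
    qed
  qed
  thus ?thesis using that P(1) by (auto simp: \<A>_def)
qed

text \<open>The ideal (p) is proper because 1/p is rational but not an integer, so it lies in a
  maximal ideal. An integer prime to \<open>p\<close> in that ideal would, together with
  \<open>p\<close>, put 1 into it; hence the ideal contracts exactly to the multiples of
  \<open>p\<close>.\<close>

lemma primes_over_nonempty:
  assumes p: "prime p"
  shows "primes_over K p \<noteq> {}"
proof -
  let ?I = "PIdl\<^bsub>R\<^esub> (of_nat p)"
  have I: "ideal ?I R" by (rule cgenideal_ideal[OF R_of_nat])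
  have "1 \<notin> ?I"
  proof
    assume "1 \<in> ?I"
    then obtain x where x: "x \<in> carrier R" "1 = x * of_nat p"
      by (auto simp: cgenideal_def)
    have p0: "(of_nat p :: complex) \<noteq> 0" using p by auto
    hence "x = 1 / of_nat p" using x(2) by (simp add: field_simps)
    hence "x \<in> \<int>" using x(1) R_ints_iff[of x] by auto
    then obtain k where "x = of_int k" by (auto elim: Ints_cases)
    hence "of_int 1 = (of_int (k * int p) :: complex)" using x(2) by simp
    hence "1 = k * int p" by (subst (asm) of_int_eq_iff)
    hence "int p dvd 1" by (metis dvd_triv_right)
    thus False using p by auto
  qed
  then obtain P where P: "maximalideal P R" "?I \<subseteq> P"
    using exists_maximalideal[OF I] by blast
  have prP: "primeideal P R" using maximalideal_prime[OF P(1)] .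
  hence id: "ideal P R" by (rule primeideal.axioms)
  have pP: "of_nat p \<in> P" using P(2) cgenideal_self[OF R_of_nat] by blast
  have "1 \<notin> P" using ideal.one_imp_carrier[OF id] primeideal.I_notcarr[OF prP] by auto
  have "P \<inter> \<int> = {of_int (int p * k) |k. True}"
  proof (intro equalityI subsetI)
    fix x assume "x \<in> P \<inter> \<int>"
    then obtain k where k: "x = of_int k" "of_int k \<in> P" by (auto elim: Ints_cases)
    have "int p dvd k"
    proof (rule ccontr)
      assume "\<not> int p dvd k"
      hence "gcd (int p) k = 1" using p by (metis prime_imp_coprime prime_nat_int_transfer coprime_iff_gcd_eq_1)
      thus False using ideal_mem_gcd[OF id R_1, of "int p" k] k pP \<open>1 \<notin> P\<close> by simp
    qed
    thus "x \<in> {of_int (int p * k) |k. True}" using k by auto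
  next
    fix x :: complex assume "x \<in> {of_int (int p * k) |k. True}"
    then obtain k where "x = of_int k * of_nat p" by (auto simp: mult.commute)
    thus "x \<in> P \<inter> \<int>" using ideal_mult[OF id pP R_of_int] by auto
  qed
  thus ?thesis using prP by (auto simp: primes_over_def)
qed

section \<open>Powers of a prime ideal\<close>

lemma ideal_pow_is_ideal:
  assumes "ideal P R"
  shows "ideal (P [^]\<^bsub>ideals_set R\<^esub> (k::nat)) R"
proof -
  interpret S: semiring "ideals_set R" by (rule ideals_set_is_semiring)
  have "P [^]\<^bsub>ideals_set R\<^esub> k \<in> carrier (ideals_set R)"
    by (rule S.nat_pow_closed) (simp add: ideals_set_def assms)
  thus ?thesis by (simp add: ideals_set_def)
qed

lemma ideal_pow_Suc: "P [^]\<^bsub>ideals_set R\<^esub> (Suc k) = ideal_prod R (P [^]\<^bsub>ideals_set R\<^esub> k) P"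
  by (simp add: nat_pow_def ideals_set_def)

lemma power_mem_ideal_pow:
  assumes "x \<in> P"
  shows "x ^ k \<in> P [^]\<^bsub>ideals_set R\<^esub> k"
proof (induction k)
  case (Suc k)
  from ideal_prod.prod[of _ _ x P R, OF Suc assms] show ?case
    unfolding ideal_pow_Suc by (simp add: mult.commute)
qed (simp add: ideals_set_def R_1)

text \<open>
  Elements of \<open>P\<^sup>k\<close> are divisible by \<open>\<pi>\<^sup>k\<close> after localising at \<open>P\<close>, since \<open>\<pi>\<close> is a uniformiser there.
\<close>

lemma ideal_pow_imp_dvd:
  assumes P: "primeideal P R" and \<pi>: "\<pi> \<in> carrier R"
    and unif: "\<And>x. x \<in> P \<Longrightarrow> \<exists>f\<in>carrier R - P. \<exists>t\<in>carrier R. f * x = \<pi> * t"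
    and x: "x \<in> P [^]\<^bsub>ideals_set R\<^esub> (k::nat)"
  shows "\<exists>f\<in>carrier R - P. \<exists>t\<in>carrier R. f * x = \<pi> ^ k * t"
  using x
proof (induction k arbitrary: x)
  case 0
  have "1 \<notin> P" using ideal.one_imp_carrier[OF primeideal.axioms(1)[OF P]]
      primeideal.I_notcarr[OF P] by auto
  thus ?case using 0 R_1 by (intro bexI[of _ 1] bexI[of _ x]) (auto simp: ideals_set_def)
next
  case (Suc k)
  \<comment> \<open>Since \<open>P\<close> is prime, denominators outside \<open>P\<close> may be
    multiplied; \<open>f * g\<close> clears both a product and a sum.\<close>
  have ndvd: "f * g \<in> carrier R - P" if "f \<in> carrier R - P" "g \<in> carrier R - P" for f g
    using primeideal.I_prime[OF P, of f g] that by (auto simp: R_mult)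
  from Suc.prems have "x \<in> ideal_prod R (P [^]\<^bsub>ideals_set R\<^esub> k) P"
    unfolding ideal_pow_Suc .
  thus ?case
  proof (induction x rule: ideal_prod.induct)
    case (prod i j)
    obtain f t where f: "f \<in> carrier R - P" "t \<in> carrier R" "f * i = \<pi> ^ k * t"
      using Suc.IH[OF prod(1)] by blast
    obtain g u where g: "g \<in> carrier R - P" "u \<in> carrier R" "g * j = \<pi> * u"
      using unif[OF prod(2)] by blast
    have "(f * g) * (i * j) = (f * i) * (g * j)" by simp
    also have "\<dots> = \<pi> ^ Suc k * (t * u)" by (simp add: f g)
    finally show ?case using ndvd[OF f(1) g(1)] R_mult[OF f(2) g(2)] R_simps(1) by metis
  next
    case (sum x y)
    obtain f t where f: "f \<in> carrier R - P" "t \<in> carrier R" "f * x = \<pi> ^ Suc k * t"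
      using sum by blast
    obtain g u where g: "g \<in> carrier R - P" "u \<in> carrier R" "g * y = \<pi> ^ Suc k * u"
      using sum by blast
    have "(f * g) * (x + y) = g * (f * x) + f * (g * y)" by (simp add: algebra_simps)
    also have "\<dots> = \<pi> ^ Suc k * (g * t + f * u)" unfolding f(3) g(3) by (simp add: algebra_simps)
    finally have "(f * g) * (x \<oplus>\<^bsub>R\<^esub> y) = \<pi> ^ Suc k * (g * t + f * u)" by simp
    moreover have "g * t + f * u \<in> carrier R" using f g by (simp add: R_mult R_add)
    ultimately show ?case using ndvd[OF f(1) g(1)] by blast
  qed
qed

text \<open>At every prime \<open>P\<close> over \<open>p\<close>, \<open>\<gamma>\<close> is a
  unit, because it divides the integer \<open>r\<close> prime to \<open>p\<close>, and the Frobenius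
  congruence makes \<open>\<pi>\<close> a uniformiser. So \<open>p\<close> is
  \<open>\<pi> ^ n\<close> up to a local unit, which places it in the \<open>n\<close>-th power of
  \<open>P\<close> and in no higher one.\<close>

theorem has_ramification_indexI:
  assumes p: "prime p" and n: "n > 0"
    and mem: "\<pi> \<in> carrier R" "\<gamma> \<in> carrier R" "\<delta> \<in> carrier R"
    and \<pi>: "\<pi> ^ n = of_nat p * \<gamma>"
    and unit: "\<gamma> * \<delta> = of_int r" "\<not> int p dvd r"
    and frob: "\<And>x. x \<in> carrier R \<Longrightarrow>
      \<exists>q s t. q > 1 \<and> \<not> int p dvd s \<and> t \<in> carrier R \<and> of_int s * (x ^ q - x) = \<pi> * t"
  shows "has_ramification_index K p n"
proof -
  have "prime_ramification_index K p P = n" if "P \<in> primes_over K p" for P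
  proof -
    have P: "primeideal P R" and Pint: "P \<inter> \<int> = {of_int (int p * k) |k. True}"
      using that by (auto simp: primes_over_def)
    have id: "ideal P R" using P by (rule primeideal.axioms)
    have int_mem: "of_int k \<in> P \<longleftrightarrow> int p dvd k" for k
    proof -
      have "of_int k \<in> P \<longleftrightarrow> (of_int k :: complex) \<in> {of_int (int p * k) |k. True}"
        unfolding Pint[symmetric] by simp
      also have "\<dots> \<longleftrightarrow> int p dvd k" by (auto simp: dvd_def simp del: of_int_mult)
      finally show ?thesis .
    qed
    have pP: "of_nat p \<in> P" using int_mem[of "int p"] by simp
    have I_prime: "x \<in> P \<or> y \<in> P" if "x \<in> carrier R" "y \<in> carrier R" "x * y \<in> P" for x y
      using primeideal.I_prime[OF P, of x y] that by simp
    have "\<pi> ^ n \<in> P" using \<pi> ideal_mult[OF id pP mem(2)] by (simp add: mult.commute)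
    hence \<pi>P: "\<pi> \<in> P"
    proof (induction n)
      case 0
      thus ?case using int_mem[of 1] p by auto
    next
      case (Suc n)
      thus ?case using I_prime[OF mem(1) R_power[OF mem(1)], of n] by auto
    qed
    have unif: "\<exists>f\<in>carrier R - P. \<exists>t\<in>carrier R. f * x = \<pi> * t" if x: "x \<in> P" for x
    proof -
      have xR: "x \<in> carrier R" using ideal.Icarr[OF id x] .
      obtain q s t where qst: "q > 1" "\<not> int p dvd s" "t \<in> carrier R"
        "of_int s * (x ^ q - x) = \<pi> * t" using frob[OF xR] by blast
      obtain q' where q': "q = Suc (Suc q')" using less_imp_Suc_add[OF qst(1)] by auto
      \<comment> \<open>Here \<open>Suc q'\<close> is \<open>q - 1\<close>, so
        \<open>h * x = x ^ q - x\<close>. As \<open>x\<close> lies in \<open>P\<close>,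
        \<open>h\<close> is -1 modulo \<open>P\<close>; thus \<open>of_int s * h\<close> stays
        outside \<open>P\<close> and serves as the denominator \<open>f\<close>.\<close>
      define h where "h = x ^ Suc q' - 1"
      have hR: "h \<in> carrier R" unfolding h_def by (intro R_diff R_power xR R_1)
      have "h \<notin> P"
      proof
        assume "h \<in> P"
        hence "x ^ q' * x + (- 1) * h \<in> P"
          using ideal_add[OF id ideal_mult[OF id x R_power[OF xR]] ideal_mult[OF id _ R_uminus[OF R_1]]]
          by blast
        hence "of_int 1 \<in> P" by (simp add: h_def mult.commute)
        thus False using int_mem[of 1] p by auto
      qed
      moreover have "of_int s \<notin> P" using int_mem qst(2) by simp
      ultimately have "of_int s * h \<in> carrier R - P" using I_prime[OF R_of_int hR] hR
        by (auto simp: R_mult R_of_int)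
      moreover have "of_int s * h * x = \<pi> * t"
        using qst(4) by (simp add: h_def q' algebra_simps)
      ultimately show ?thesis using qst(3) by blast
    qed
    \<comment> \<open>For \<open>k > n\<close>, multiplying
      \<open>f * of_nat p = \<pi> ^ k * t\<close> by \<open>\<gamma>\<close> and cancelling
      \<open>\<pi> ^ n\<close> would exhibit \<open>f\<close> as a multiple of \<open>\<pi>\<close>,
      hence as a member of \<open>P\<close>.\<close>
    have le: "k \<le> n" if sub: "PIdl\<^bsub>R\<^esub> (of_nat p) \<subseteq> P [^]\<^bsub>ideals_set R\<^esub> k" for k
    proof (rule ccontr)
      assume "\<not> k \<le> n"
      then obtain j where j: "k = n + Suc j" by (metis add_Suc_right less_imp_Suc_add not_le)
      have "of_nat p \<in> P [^]\<^bsub>ideals_set R\<^esub> k" using sub cgenideal_self[OF R_of_nat] by blast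
      then obtain f t where f: "f \<in> carrier R - P" "t \<in> carrier R" "f * of_nat p = \<pi> ^ k * t"
        using ideal_pow_imp_dvd[OF P mem(1) unif] by blast
      have "\<pi> ^ n * f = \<gamma> * (f * of_nat p)" unfolding \<pi> by simp
      also have "\<dots> = \<pi> ^ n * ((\<pi> ^ j * t * \<gamma>) * \<pi>)" unfolding f(3) j by (simp add: power_add)
      finally have "\<pi> ^ n * f = \<pi> ^ n * ((\<pi> ^ j * t * \<gamma>) * \<pi>)" .
      moreover have "\<pi> ^ n \<noteq> 0"
      proof -
        have "\<gamma> \<noteq> 0" using unit by auto
        thus ?thesis using p by (auto simp: \<pi>)
      qed
      ultimately have "f = (\<pi> ^ j * t * \<gamma>) * \<pi>"
        using mult_left_cancel by blast
      hence "f \<in> P" using ideal_mult[OF id \<pi>P] f(2) mem by (simp add: R_mult R_power)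
      thus False using f(1) by simp
    qed
    have "of_nat p \<in> P [^]\<^bsub>ideals_set R\<^esub> n" (is "_ \<in> ?Pn")
    proof -
      have idn: "ideal ?Pn R" by (rule ideal_pow_is_ideal[OF id])
      \<comment> \<open>Two multiples of \<open>p\<close> are seen to lie in the \<open>n\<close>-th
        power of \<open>P\<close>: by \<open>r\<close>, because
        \<open>\<delta> * \<pi> ^ n = r * p\<close>, and by \<open>p ^ n\<close>, because
        \<open>p\<close> lies in \<open>P\<close>. The multipliers are coprime, so \<open>p\<close>
        itself lies there.\<close>
      have "\<delta> * \<pi> ^ n \<in> ?Pn" by (rule ideal_mult[OF idn power_mem_ideal_pow[OF \<pi>P] mem(3)])
      moreover have "\<delta> * \<pi> ^ n = of_int r * of_nat p" unfolding \<pi> unit(1)[symmetric] by simp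
      ultimately have 1: "of_int r * of_nat p \<in> ?Pn" by simp
      have "of_nat p * of_nat p ^ n \<in> ?Pn"
        by (rule ideal_mult[OF idn power_mem_ideal_pow[OF pP] R_of_nat])
      hence 2: "of_int (int p ^ n) * of_nat p \<in> ?Pn" by (simp add: mult.commute)
      have "gcd r (int p ^ n) = 1"
        using unit(2) p by (metis coprime_power_right_iff prime_imp_coprime prime_nat_int_transfer
            coprime_commute coprime_iff_gcd_eq_1)
      thus ?thesis using ideal_mem_gcd[OF idn R_of_nat 1 2] by simp
    qed
    hence "PIdl\<^bsub>R\<^esub> (of_nat p) \<subseteq> P [^]\<^bsub>ideals_set R\<^esub> n"
      by (rule cgenideal_minimal[OF ideal_pow_is_ideal[OF id]])
    thus ?thesis unfolding prime_ramification_index_def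
      by (rule Greatest_equality) (rule le)
  qed
  thus ?thesis using primes_over_nonempty[OF p] unfolding has_ramification_index_def by force
qed

end

section \<open>Orders on which Frobenius is trivial\<close>

text \<open>As \<open>y\<close> is nonzero, factors of the variable can be cancelled from
  \<open>p\<close> until the constant term \<open>c\<close> is nonzero. Moving \<open>c\<close> to
  the other side gives \<open>k = - c\<close>. This inverts \<open>y\<close> up to an
  integer.\<close>

lemma exists_integer_multiple:
  fixes y :: "'a::field_char_0"
  assumes "p \<noteq> 0" "poly (map_poly of_int p) y = 0" "y \<noteq> 0"
  shows "\<exists>h k. k \<noteq> 0 \<and> y * poly (map_poly of_int h) y = of_int k"
  using assms
proof (induction p)
  case (pCons c h)
  show ?case
  proof (cases "c = 0")
    case True
    thus ?thesis using pCons by auto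
  next
    case False
    have "y * poly (map_poly of_int h) y = of_int (- c)"
      using pCons.prems(2) pCons.hyps
      by (simp add: eq_neg_iff_add_eq_0 add.commute map_poly_pCons)
    thus ?thesis using False by (metis neg_equal_0_iff_equal)
  qed
qed simp

section \<open>Congruences and Frobenius in a subring\<close>

context complex_subring
begin

lemma diff: "x \<in> K \<Longrightarrow> y \<in> K \<Longrightarrow> x - y \<in> K"
  using add[of x "- y"] uminus[of y] by simp

lemma power: "x \<in> K \<Longrightarrow> x ^ n \<in> K"
  by (induction n) (auto intro: one mult)

lemma sum: "(\<And>i. i \<in> I \<Longrightarrow> f i \<in> K) \<Longrightarrow> sum f I \<in> K"
  by (induction I rule: infinite_finite_induct) (auto intro: add zero)

lemma poly_of_int: "y \<in> K \<Longrightarrow> poly (map_poly of_int h) y \<in> K"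
  by (induction h) (auto simp: zero of_int_mem add mult)

definition cong_mod :: "complex \<Rightarrow> complex \<Rightarrow> complex \<Rightarrow> bool" where
  "cong_mod w x y \<longleftrightarrow> (\<exists>t\<in>K. x - y = w * t)"

lemma cong_mod_refl: "cong_mod w x x"
  unfolding cong_mod_def by (rule bexI[OF _ zero]) simp

lemma cong_mod_trans: "cong_mod w x y \<Longrightarrow> cong_mod w y z \<Longrightarrow> cong_mod w x z"
proof -
  assume "cong_mod w x y" "cong_mod w y z"
  then obtain t u where "t \<in> K" "u \<in> K" "x - y = w * t" "y - z = w * u"
    by (auto simp: cong_mod_def)
  hence "x - z = w * (t + u)" "t + u \<in> K" by (auto simp: algebra_simps add)
  thus ?thesis by (auto simp: cong_mod_def)
qed

lemma cong_mod_sym: "cong_mod w x y \<Longrightarrow> cong_mod w y x"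
proof -
  assume "cong_mod w x y"
  then obtain t where "t \<in> K" "x - y = w * t" by (auto simp: cong_mod_def)
  hence "y - x = w * (- t)" "- t \<in> K" by (auto simp: algebra_simps uminus)
  thus ?thesis unfolding cong_mod_def by blast
qed

lemma cong_mod_add: "cong_mod w x y \<Longrightarrow> cong_mod w x' y' \<Longrightarrow> cong_mod w (x + x') (y + y')"
proof -
  assume "cong_mod w x y" "cong_mod w x' y'"
  then obtain t u where "t \<in> K" "u \<in> K" "x - y = w * t" "x' - y' = w * u"
    by (auto simp: cong_mod_def)
  hence "(x + x') - (y + y') = w * (t + u)" "t + u \<in> K" by (auto simp: algebra_simps add)
  thus ?thesis unfolding cong_mod_def by blast
qed

lemma cong_mod_mult:
  assumes "cong_mod w x y" "cong_mod w x' y'" "y \<in> K" "x' \<in> K"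
  shows "cong_mod w (x * x') (y * y')"
proof -
  obtain t u where tu: "t \<in> K" "u \<in> K" "x - y = w * t" "x' - y' = w * u"
    using assms by (auto simp: cong_mod_def)
  have "x * x' - y * y' = (x - y) * x' + y * (x' - y')" by (simp add: algebra_simps)
  also have "\<dots> = w * (t * x' + y * u)" by (simp add: tu algebra_simps)
  finally show ?thesis using tu assms unfolding cong_mod_def by (blast intro: add mult)
qed

lemma cong_mod_power:
  assumes "cong_mod w x y" "x \<in> K" "y \<in> K"
  shows "cong_mod w (x ^ n) (y ^ n)"
  by (induction n) (auto intro!: cong_mod_refl cong_mod_mult assms power)

lemma cong_mod_multiple: "t \<in> K \<Longrightarrow> cong_mod w (w * t) 0"
  by (auto simp: cong_mod_def)

text \<open>The inner binomial coefficients are divisible by \<open>p\<close>, and \<open>w\<close>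
  divides \<open>p\<close>.\<close>

lemma cong_mod_power_add_prime:
  assumes p: "prime p" "cong_mod w (of_nat p) 0" and K: "x \<in> K" "y \<in> K"
  shows "cong_mod w ((x + y) ^ p) (x ^ p + y ^ p)"
proof -
  obtain c where c: "c \<in> K" "of_nat p = w * c" using p(2) by (auto simp: cong_mod_def)
  define t where "t = (\<Sum>k\<in>{1..<p}. c * (of_nat ((p choose k) div p) * x ^ k * y ^ (p - k)))"
  have p1: "p > 0" using p(1) by (simp add: prime_gt_0_nat)
  have "(x + y) ^ p = (\<Sum>k\<le>p. of_nat (p choose k) * x ^ k * y ^ (p - k))"
    by (rule binomial_ring)
  also have "{..p} = insert 0 (insert p {1..<p})" using p1 by auto
  also have "(\<Sum>k\<in>\<dots>. of_nat (p choose k) * x ^ k * y ^ (p - k)) =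
      x ^ p + y ^ p + (\<Sum>k\<in>{1..<p}. of_nat (p choose k) * x ^ k * y ^ (p - k))"
    using p1 by simp
  also have "(\<Sum>k\<in>{1..<p}. of_nat (p choose k) * x ^ k * y ^ (p - k)) = w * t"
    unfolding t_def sum_distrib_left
  proof (rule sum.cong)
    fix k assume "k \<in> {1..<p}"
    hence "p dvd (p choose k)" using p(1) by (intro dvd_choose_prime) auto
    hence "of_nat (p choose k) = (of_nat p * of_nat ((p choose k) div p) :: complex)"
      by (metis dvd_mult_div_cancel of_nat_mult)
    thus "of_nat (p choose k) * x ^ k * y ^ (p - k) =
        w * (c * (of_nat ((p choose k) div p) * x ^ k * y ^ (p - k)))"
      by (simp add: c(2))
  qed simp
  finally have "(x + y) ^ p - (x ^ p + y ^ p) = w * t" by simp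
  moreover have "t \<in> K" unfolding t_def by (intro sum mult power c K of_nat_mem)
  ultimately show ?thesis by (auto simp: cong_mod_def)
qed

lemma cong_mod_power_add:
  assumes p: "prime p" "cong_mod w (of_nat p) 0" and K: "x \<in> K" "y \<in> K"
  shows "cong_mod w ((x + y) ^ (p ^ f)) (x ^ (p ^ f) + y ^ (p ^ f))"
proof (induction f)
  case 0
  show ?case by (simp add: cong_mod_refl)
next
  case (Suc f)
  have "cong_mod w (((x + y) ^ (p ^ f)) ^ p) ((x ^ (p ^ f) + y ^ (p ^ f)) ^ p)"
    by (intro cong_mod_power Suc power add K)
  moreover have "cong_mod w ((x ^ (p ^ f) + y ^ (p ^ f)) ^ p) ((x ^ (p ^ f)) ^ p + (y ^ (p ^ f)) ^ p)"
    by (intro cong_mod_power_add_prime p power K)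
  ultimately have "cong_mod w (((x + y) ^ (p ^ f)) ^ p) ((x ^ (p ^ f)) ^ p + (y ^ (p ^ f)) ^ p)"
    by (rule cong_mod_trans)
  thus ?case by (simp add: power_mult[symmetric] mult.commute)
qed

text \<open>
  The Frobenius hypothesis makes the quotient by \<open>w\<close> reduced, while \<open>w * y\<close> is nilpotent there
  by an integral equation for \<open>y\<close>.
\<close>

lemma mem_if_multiple_mem:
  assumes frob: "\<And>x. x \<in> K \<Longrightarrow> cong_mod w (x ^ q) x" and q: "q > 1"
    and w: "w \<in> K" "w \<noteq> 0" and y: "algebraic_int y" "w * y \<in> K"
  shows "y \<in> K"
proof -
  define z where "z = w * y"
  have zK: "z \<in> K" using y by (simp add: z_def)
  obtain d c where d: "d > 0" and c: "y ^ d = (\<Sum>i<d. of_int (c i) * y ^ i)"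
    using algebraic_int_powers_int_span[OF y(1)] .
  \<comment> \<open>Multiplying the monic equation of \<open>y\<close> by \<open>w ^ d\<close> turns
    it into one for \<open>z = w * y\<close> in which every lower term keeps a factor
    \<open>w\<close>, as \<open>i < d\<close>. Hence \<open>z ^ d = w * t\<close> with
    \<open>t\<close> in \<open>K\<close>.\<close>
  define t where "t = (\<Sum>i<d. of_int (c i) * w ^ (d - 1 - i) * z ^ i)"
  have "z ^ d = (\<Sum>i<d. w ^ d * (of_int (c i) * y ^ i))"
    unfolding z_def power_mult_distrib c by (simp add: sum_distrib_left)
  also have "\<dots> = w * t"
    unfolding t_def sum_distrib_left
  proof (rule sum.cong)
    fix i assume "i \<in> {..<d}"
    hence "d = Suc (d - 1 - i + i)" by auto
    hence "w ^ d = w * w ^ (d - 1 - i) * w ^ i" by (metis power_Suc power_add mult.assoc)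
    thus "w ^ d * (of_int (c i) * y ^ i) = w * (of_int (c i) * w ^ (d - 1 - i) * z ^ i)"
      by (simp add: z_def power_mult_distrib)
  qed simp
  finally have zd: "z ^ d = w * t" .
  have tK: "t \<in> K" unfolding t_def by (intro sum mult power of_int_mem w zK)
  have iter: "cong_mod w (z ^ (q ^ j)) z" for j
  proof (induction j)
    case (Suc j)
    have "cong_mod w ((z ^ (q ^ j)) ^ q) (z ^ q)" by (intro cong_mod_power Suc power zK)
    from cong_mod_trans[OF this frob[OF zK]] show ?case by (simp add: power_mult[symmetric] mult.commute)
  qed (simp add: cong_mod_refl)
  \<comment> \<open>Iterating Frobenius \<open>d\<close> times reaches an exponent of at least
    \<open>d\<close>, so \<open>z\<close> is congruent to \<open>z ^ (q ^ d)\<close> and thus to 0.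
    Cancelling \<open>w\<close> gives \<open>y\<close>.\<close>
  have "d \<le> q ^ d" using power_gt_expt[of q d] q by simp
  hence "z ^ (q ^ d) = w * (t * z ^ (q ^ d - d))"
    using zd by (metis le_add_diff_inverse power_add mult.assoc)
  hence "cong_mod w (z ^ (q ^ d)) 0"
    using cong_mod_multiple[of "t * z ^ (q ^ d - d)" w] tK zK by (simp add: mult power)
  hence "cong_mod w z 0" using cong_mod_trans[OF cong_mod_sym[OF iter]] by blast
  then obtain u where "u \<in> K" "z = w * u" by (auto simp: cong_mod_def)
  thus ?thesis using w(2) by (simp add: z_def)
qed

text \<open>Factors \<open>w\<close> are cancelled one at a time; integrality of \<open>w\<close>
  keeps the intermediate elements \<open>w ^ N * y\<close> integral.\<close>

lemma mem_if_power_multiple_mem: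
  assumes frob: "\<And>x. x \<in> K \<Longrightarrow> cong_mod w (x ^ q) x" and q: "q > 1"
    and w: "w \<in> K" "w \<noteq> 0" "algebraic_int w" and y: "algebraic_int y"
  shows "w ^ N * y \<in> K \<Longrightarrow> y \<in> K"
proof (induction N)
  case (Suc N)
  have "w ^ N * y \<in> K"
    by (rule mem_if_multiple_mem[OF frob q w(1,2)])
       (use Suc.prems in \<open>auto intro: algebraic_int_mult algebraic_int_power w y simp: mult_ac\<close>)
  thus ?case by (rule Suc.IH)
qed simp

end

section \<open>Fields generated over the rationals\<close>

lemma ring_of_type_algebra_simps:
  "\<one>\<^bsub>ring_of_type_algebra\<^esub> = (1 :: 'a::Fields.field)"
  "\<zero>\<^bsub>ring_of_type_algebra\<^esub> = (0 :: 'a)"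
  "x \<oplus>\<^bsub>ring_of_type_algebra\<^esub> y = (x + y :: 'a)"
  "x \<otimes>\<^bsub>ring_of_type_algebra\<^esub> y = (x * y :: 'a)"
  "\<ominus>\<^bsub>ring_of_type_algebra\<^esub> x = (- x :: 'a)"
  "x \<noteq> 0 \<Longrightarrow> inv\<^bsub>ring_of_type_algebra\<^esub> x = inverse x"
proof -
  interpret F: field "ring_of_type_algebra :: 'a ring" by (rule field_from_type_algebra)
  show "\<ominus>\<^bsub>ring_of_type_algebra\<^esub> x = - x"
    by (rule F.minus_equality) (simp_all add: ring_of_type_algebra_def)
  show "inv\<^bsub>ring_of_type_algebra\<^esub> x = inverse x" if "x \<noteq> 0"
    by (rule F.comm_inv_char) (use that in \<open>simp_all add: ring_of_type_algebra_def\<close>)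
qed (simp_all add: ring_of_type_algebra_def)

lemma rat_adjoin_least:
  assumes L: "complex_subring L" "\<And>x. x \<in> L \<Longrightarrow> x \<noteq> 0 \<Longrightarrow> inverse x \<in> L" and "S \<subseteq> L"
  shows "rat_adjoin S \<subseteq> L"
proof
  interpret L: complex_subring L by fact
  fix x assume "x \<in> rat_adjoin S"
  thus "x \<in> L" unfolding rat_adjoin_def
    by (induction x rule: generate_field.induct)
       (use assms in \<open>auto simp: ring_of_type_algebra_simps L.one L.add L.mult L.uminus\<close>)
qed

lemma complex_subring_rat_adjoin: "complex_subring (rat_adjoin S)"
  using generate_field.one[of "ring_of_type_algebra :: complex ring" S]
    generate_field.a_inv[of _ "ring_of_type_algebra :: complex ring" S]
    generate_field.eng_add[of _ "ring_of_type_algebra :: complex ring" S]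
    generate_field.eng_mult[of _ "ring_of_type_algebra :: complex ring" S]
  by unfold_locales (auto simp: rat_adjoin_def ring_of_type_algebra_simps)

lemma rat_adjoin_inverse: "x \<in> rat_adjoin S \<Longrightarrow> inverse x \<in> rat_adjoin S"
proof (cases "x = 0")
  case False
  assume "x \<in> rat_adjoin S"
  thus ?thesis using generate_field.m_inv[of x ring_of_type_algebra S] False
    by (simp add: rat_adjoin_def ring_of_type_algebra_simps)
qed simp

lemma rat_adjoin_divide: "x \<in> rat_adjoin S \<Longrightarrow> y \<in> rat_adjoin S \<Longrightarrow> x / y \<in> rat_adjoin S"
  using complex_subring.mult[OF complex_subring_rat_adjoin] rat_adjoin_inverse
  by (simp add: divide_inverse)

lemma rat_adjoin_incl: "x \<in> S \<Longrightarrow> x \<in> rat_adjoin S"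
  unfolding rat_adjoin_def by (rule generate_field.incl)

text \<open>The ring \<open>L\<close>, obtained from \<open>K\<close> by inverting \<open>w\<close>,
  is a field: every nonzero element divides a nonzero integer up to factors from \<open>L\<close>,
  and nonzero integers are invertible in \<open>L\<close> by assumption. As \<open>L\<close>
  contains \<open>S\<close>, it contains the field generated by \<open>S\<close>.\<close>

lemma (in complex_subring) rat_adjoin_localisation:
  assumes w: "w \<in> K" "w \<noteq> 0"
    and denom: "\<And>z. z \<in> K \<Longrightarrow> \<exists>s::int. s \<noteq> 0 \<and> algebraic_int (of_int s * z)"
    and int: "\<And>k::int. k \<noteq> 0 \<Longrightarrow> \<exists>N. w ^ N * inverse (of_int k) \<in> K"
    and S: "\<And>x. x \<in> S \<Longrightarrow> \<exists>N. w ^ N * x \<in> K"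
    and x: "x \<in> rat_adjoin S"
  shows "\<exists>N. w ^ N * x \<in> K"
proof -
  define L where "L = {x. \<exists>N. w ^ N * x \<in> K}"
  have L_mult: "x * y \<in> L" if xy: "x \<in> L" "y \<in> L" for x y
  proof -
    obtain M N where "w ^ M * x \<in> K" "w ^ N * y \<in> K" using xy by (auto simp: L_def)
    from mult[OF this] have "w ^ (M + N) * (x * y) \<in> K" by (simp add: power_add mult_ac)
    thus ?thesis by (auto simp: L_def)
  qed
  have KL: "x \<in> L" if "x \<in> K" for x
    using that unfolding L_def by (intro CollectI exI[of _ 0]) simp
  have "x + y \<in> L" if xy: "x \<in> L" "y \<in> L" for x y
  proof -
    obtain M N where "w ^ M * x \<in> K" "w ^ N * y \<in> K" using xy by (auto simp: L_def)
    hence "w ^ N * (w ^ M * x) + w ^ M * (w ^ N * y) \<in> K"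
      using add mult power w(1) by presburger
    hence "w ^ (M + N) * (x + y) \<in> K" by (simp add: power_add algebra_simps)
    thus ?thesis by (auto simp: L_def)
  qed
  moreover have "- x \<in> L" if "x \<in> L" for x
    using that by (auto simp: L_def dest: uminus)
  ultimately have L: "complex_subring L" using KL[OF one] L_mult by unfold_locales
  have w_inv: "inverse (w ^ N) \<in> L" for N
    using w one unfolding L_def by (intro CollectI exI[of _ N]) simp
  have "inverse x \<in> L" if "x \<in> L" "x \<noteq> 0" for x
  proof -
    obtain N where N: "w ^ N * x \<in> K" using \<open>x \<in> L\<close> by (auto simp: L_def)
    obtain s :: int where s: "s \<noteq> 0" "algebraic_int (of_int s * (w ^ N * x))"
      using denom[OF N] by blast
    \<comment> \<open>\<open>y\<close> is a nonzero algebraic integer in \<open>K\<close>. With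
      \<open>h\<close> and \<open>k\<close> such that \<open>y\<close> times the value of
      \<open>h\<close> at \<open>y\<close> is \<open>k\<close>, the inverse of \<open>x\<close> is
      \<open>s * w ^ N\<close> times that value, divided by \<open>k\<close>.\<close>
    define y where "y = of_int s * (w ^ N * x)"
    have y: "y \<in> K" "y \<noteq> 0" using s \<open>x \<noteq> 0\<close> w N by (auto simp: y_def mult of_int_mem)
    obtain P where P: "poly (map_poly of_int P) y = 0" "lead_coeff P = 1"
      using s(2) unfolding y_def[symmetric] by (auto simp: algebraic_int_altdef_ipoly)
    obtain h k where hk: "k \<noteq> 0" "y * poly (map_poly of_int h) y = of_int k"
      using exists_integer_multiple[of P y] P y(2) by (metis leading_coeff_0_iff zero_neq_one)
    have k0: "(of_int k :: complex) \<noteq> 0" using hk(1) by simp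
    have "inverse x = of_int s * w ^ N * poly (map_poly of_int h) y * inverse (of_int k)"
      using hk(2) k0 \<open>x \<noteq> 0\<close> unfolding y_def by (simp add: field_simps)
    moreover have "inverse (of_int k) \<in> L" using int[OF hk(1)] by (simp add: L_def)
    moreover have "of_int s * w ^ N * poly (map_poly of_int h) y \<in> L"
      by (intro KL mult of_int_mem power w poly_of_int y)
    ultimately show ?thesis using L_mult by simp
  qed
  hence "rat_adjoin S \<subseteq> L"
    using rat_adjoin_least[OF L] S by (auto simp: L_def)
  thus ?thesis using x by (auto simp: L_def)
qed

section \<open>Frobenius on a generated ring\<close>

inductive_set generated_subring :: "'a::comm_ring_1 set \<Rightarrow> 'a set" for S where
  one: "1 \<in> generated_subring S"
| base: "x \<in> S \<Longrightarrow> x \<in> generated_subring S"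
| uminus: "x \<in> generated_subring S \<Longrightarrow> - x \<in> generated_subring S"
| add: "x \<in> generated_subring S \<Longrightarrow> y \<in> generated_subring S \<Longrightarrow> x + y \<in> generated_subring S"
| mult: "x \<in> generated_subring S \<Longrightarrow> y \<in> generated_subring S \<Longrightarrow> x * y \<in> generated_subring S"

lemma complex_subring_generated_subring: "complex_subring (generated_subring S)"
  by unfold_locales (rule generated_subring.intros; assumption)+

lemma generated_subring_least:
  assumes "complex_subring L" "S \<subseteq> L"
  shows "generated_subring S \<subseteq> L"
proof
  interpret L: complex_subring L by fact
  fix x assume "x \<in> generated_subring S"
  thus "x \<in> L"
    by (induction x) (use assms in \<open>auto simp: L.one L.add L.mult L.uminus\<close>)
qed

text \<open>As \<open>w\<close> divides \<open>p\<close>, raising to the power \<open>p ^ f\<close>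
  is additive as well as multiplicative modulo \<open>w\<close>, so the congruence spreads from the
  generators to the whole ring.\<close>

lemma generated_subring_frobenius:
  fixes S :: "complex set"
  defines "A \<equiv> generated_subring S"
  assumes p: "prime p" "complex_subring.cong_mod A w (of_nat p) 0"
    and S: "\<And>x. x \<in> S \<Longrightarrow> complex_subring.cong_mod A w (x ^ (p ^ f)) x"
    and x: "x \<in> A"
  shows "complex_subring.cong_mod A w (x ^ (p ^ f)) x"
proof -
  interpret A: complex_subring A
    unfolding A_def by (rule complex_subring_generated_subring)
  show ?thesis using x unfolding A_def
  proof (induction x)
    case one
    show ?case by (simp add: A.cong_mod_refl[unfolded A_def])
  next
    case (base x)
    thus ?case using S by (simp add: A_def)
  next
    case (uminus x)
    hence xA: "x \<in> A" by (simp add: A_def)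
    have q0: "p ^ f > 0" using p(1) by (simp add: prime_gt_0_nat)
    \<comment> \<open>Additivity applied to \<open>x + - x = 0\<close> shows that
      \<open>a + b\<close> is congruent to 0. This treats \<open>p = 2\<close> and odd
      \<open>p\<close> alike, without evaluating the sign.\<close>
    define a b where "a = x ^ (p ^ f)" and "b = (- x) ^ (p ^ f)"
    have "A.cong_mod w ((x + - x) ^ (p ^ f)) (a + b)"
      unfolding a_def b_def by (intro A.cong_mod_power_add p A.uminus xA)
    hence "A.cong_mod w (a + b) 0"
      using A.cong_mod_sym[of w "0 ^ (p ^ f)" "a + b"] zero_power[OF q0, where ?'a = complex]
      by simp
    moreover have "A.cong_mod w x a"
      unfolding a_def by (rule A.cong_mod_sym[OF uminus.IH[folded A_def]])
    ultimately have "A.cong_mod w ((a + b) + x) (0 + a)" by (rule A.cong_mod_add)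
    from A.cong_mod_add[OF this A.cong_mod_refl[of w "- x - a"]]
    have "A.cong_mod w b (- x)" by (simp add: algebra_simps)
    thus ?case by (simp add: b_def A_def)
  next
    case (add x y)
    hence "x \<in> A" "y \<in> A" by (simp_all add: A_def)
    from A.cong_mod_trans[OF A.cong_mod_power_add[OF p this] A.cong_mod_add[OF add.IH[folded A_def]]]
    show ?case by (simp add: A_def)
  next
    case (mult x y)
    hence "x \<in> A" "y \<in> A" by (simp_all add: A_def)
    hence "A.cong_mod w (x ^ (p ^ f) * y ^ (p ^ f)) (x * y)"
      by (intro A.cong_mod_mult mult.IH[folded A_def] A.power)
    thus ?case by (simp add: A_def power_mult_distrib)
  qed
qed

section \<open>Kummer extensions\<close>

lemma int_power_eq_1_mod_prime:
  fixes u :: int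
  assumes p: "prime p" and u: "\<not> int p dvd u" and e: "(p - 1) dvd e"
  obtains k where "u ^ e = 1 + int p * k"
proof -
  \<comment> \<open>Fermat's theorem is applied to natural numbers, so the possibly negative
    \<open>u\<close> is replaced by its residue.\<close>
  define r where "r = nat (u mod int p)"
  have p0: "int p > 0" using p by (simp add: prime_gt_0_nat)
  hence r: "int r = u mod int p" by (simp add: r_def)
  hence "\<not> int p dvd int r" using u by (simp add: dvd_eq_mod_eq_0)
  hence "[r ^ (p - 1) = 1] (mod p)" using p by (intro fermat_theorem) simp_all
  hence "[int r ^ (p - 1) = 1] (mod int p)" by (metis cong_int_iff of_nat_1 of_nat_power)
  moreover have "[u = int r] (mod int p)" by (simp add: r cong_def)
  ultimately have "[u ^ (p - 1) = 1] (mod int p)" using cong_pow cong_trans by blast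
  moreover obtain j where "e = (p - 1) * j" using e by blast
  ultimately have "[u ^ e = 1] (mod int p)"
    by (metis cong_pow power_mult power_one)
  then obtain k where "u ^ e - 1 = int p * k" by (auto simp: cong_iff_dvd_diff)
  thus ?thesis using that[of k] by simp
qed

text \<open>Euler's theorem for the modulus \<open>m * (p - 1)\<close>, to which \<open>p\<close> is
  prime; the exponent is the totient of this modulus.\<close>

lemma prime_power_frobenius_exponent:
  fixes p m :: nat
  assumes p: "prime p" "\<not> p dvd m" and m: "m > 0"
  obtains f where "p ^ f > 1" "m * (p - 1) dvd p ^ f - 1"
proof -
  define M where "M = m * (p - 1)"
  have p1: "p > 1" using p(1) by (rule prime_gt_1_nat)
  have "coprime p m" using p by (simp add: prime_imp_coprime)
  moreover have "coprime p (p - 1)" by (rule coprime_diff_one_right_nat) (use p1 in simp)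
  ultimately have "coprime p M" by (simp add: M_def)
  hence "[p ^ totient M = 1] (mod M)" by (rule euler_theorem)
  hence "M dvd p ^ totient M - 1" using p1 cong_to_1_nat by blast
  moreover have "totient M > 0" using m p1 by (simp add: M_def)
  hence "p ^ totient M > 1" by (intro one_less_power p1)
  ultimately show ?thesis using that M_def by blast
qed

text \<open>
  \<open>A\<close> is the localisation of \<open>\<int>[\<zeta>, \<beta>, \<pi>]\<close> at the integers prime to \<open>p\<close>. In \<open>A\<close> every element
  satisfies \<open>x\<^sup>q \<equiv> x\<close> modulo \<open>\<pi>\<close>, hence \<open>A\<close> contains all the algebraic integers of
  \<open>A[1/\<pi>] = \<rat>(\<zeta>, \<alpha>)\<close>.
\<close>

lemma has_ramification_index_rat_adjoin:
  fixes u :: int and m g n x w y p :: nat and \<zeta> \<alpha> \<beta> \<pi> :: complex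
  defines "K \<equiv> rat_adjoin {\<zeta>, \<alpha>}"
  assumes p: "prime p" "\<not> p dvd m" and m: "m > 0" "g dvd m" and n: "n > 0"
    and \<zeta>: "\<zeta> ^ m = 1" and \<beta>: "\<beta> ^ g = of_int u" and u: "\<not> int p dvd u"
    and \<pi>: "\<pi> ^ n = of_nat p * \<beta> ^ x" and \<alpha>: "\<alpha> * \<beta> ^ y = \<pi> ^ w * \<beta>"
    and mem: "\<beta> \<in> K" "\<pi> \<in> K"
  shows "has_ramification_index K p n"
proof -
  define S where "S = {\<zeta>, \<beta>, \<pi>} \<union> {inverse (of_nat s) | s. \<not> p dvd s}"
  define A where "A = generated_subring S"
  interpret K: complex_subring K unfolding K_def by (rule complex_subring_rat_adjoin)
  interpret A: complex_subring A unfolding A_def by (rule complex_subring_generated_subring)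
  have SA: "x \<in> A" if "x \<in> S" for x unfolding A_def by (rule generated_subring.base[OF that])
  have gen: "\<zeta> \<in> A" "\<beta> \<in> A" "\<pi> \<in> A" by (auto intro!: SA simp: S_def)
  have inv_nat: "inverse (of_nat s) \<in> A" if "\<not> p dvd s" for s
    using that by (auto intro!: SA simp: S_def)
  have inv_int: "inverse (of_int k) \<in> A" if "\<not> int p dvd k" for k
  proof -
    obtain s where "k = int s \<or> k = - int s" by (metis int_cases2)
    thus ?thesis using inv_nat[of s] that A.uminus[of "inverse (of_nat s)"] by auto
  qed
  have g: "g > 0" using m by (auto intro: Nat.gr0I)
  have u0: "(of_int u :: complex) \<noteq> 0" using u by auto
  \<comment> \<open>The inverse of \<open>\<beta>\<close>: since \<open>\<beta> ^ g = u\<close> and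
    \<open>u\<close> is prime to \<open>p\<close>, \<open>\<beta>\<close> is a unit of
    \<open>A\<close>.\<close>
  define bi where "bi = \<beta> ^ (g - 1) * inverse (of_int u)"
  have bi: "\<beta> * bi = 1" "bi \<in> A"
  proof -
    have "\<beta> * \<beta> ^ (g - 1) = of_int u" using g \<beta> by (metis Suc_diff_1 power_Suc)
    thus "\<beta> * bi = 1" using u0 by (simp add: bi_def mult.assoc[symmetric])
    show "bi \<in> A" unfolding bi_def by (intro A.mult A.power gen inv_int u)
  qed
  have bi_pow: "\<beta> ^ k * bi ^ k = 1" for k by (simp add: power_mult_distrib[symmetric] bi)
  have "\<alpha> = \<pi> ^ w * \<beta> * bi ^ y"
    using \<alpha>[symmetric] bi_pow[of y] by (simp add: mult.assoc)
  hence \<alpha>A: "\<alpha> \<in> A" using gen bi by (auto intro!: A.mult A.power)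
  have p0: "(of_nat p :: complex) \<noteq> 0" using p by auto
  have \<pi>0: "\<pi> \<noteq> 0" using \<pi> n p0 bi(1) by (auto simp: power_0_left)
  \<comment> \<open>The cofactor of \<open>\<pi>\<close> in \<open>p\<close>, read off from
    \<open>\<pi> ^ n = p * \<beta> ^ x\<close>.\<close>
  define c where "c = \<pi> ^ (n - 1) * bi ^ x"
  have cA: "c \<in> A" unfolding c_def by (intro A.mult A.power gen bi)
  have pc: "of_nat p = \<pi> * c"
  proof -
    have "\<pi> * c = \<pi> ^ n * bi ^ x" using n by (simp add: c_def mult.assoc[symmetric] flip: power_Suc)
    thus ?thesis using bi_pow[of x] by (simp add: \<pi> mult.assoc)
  qed
  have pdvd: "A.cong_mod \<pi> (of_nat p) 0"
    unfolding pc by (rule A.cong_mod_multiple[OF cA])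
  have integral: "algebraic_int \<zeta>" "algebraic_int \<beta>" "algebraic_int \<pi>"
  proof -
    show "algebraic_int \<zeta>"
      by (rule algebraic_int_if_power_algebraic_int[OF _ m(1)]) (simp add: \<zeta>)
    show \<beta>_int: "algebraic_int \<beta>"
      by (rule algebraic_int_if_power_algebraic_int[OF _ g]) (simp add: \<beta>)
    show "algebraic_int \<pi>"
      by (rule algebraic_int_if_power_algebraic_int[OF _ n])
         (auto simp: \<pi> intro!: algebraic_int_mult algebraic_int_power \<beta>_int)
  qed
  \<comment> \<open>The factor \<open>m\<close> in the divisor makes the power map fix
    \<open>\<zeta>\<close>, the factor \<open>p - 1\<close> makes it fix integers prime to
    \<open>p\<close> modulo \<open>p\<close>, and both together, as \<open>g\<close> divides
    \<open>m\<close>, take care of \<open>\<beta>\<close>.\<close>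
  obtain f where f: "p ^ f > 1" "m * (p - 1) dvd p ^ f - 1"
    using prime_power_frobenius_exponent[OF p m(1)] .
  define q where "q = p ^ f"
  have q: "q > 1" "m * (p - 1) dvd q - 1" using f by (simp_all add: q_def)
  have q_Suc: "z ^ q = z * z ^ (q - 1)" for z :: complex
    using q(1) by (cases q) simp_all
  have unit_pow: "A.cong_mod \<pi> (of_int k ^ e) 1" if k: "\<not> int p dvd k" and e: "(p - 1) dvd e" for k e
  proof -
    obtain j where "k ^ e = 1 + int p * j" using int_power_eq_1_mod_prime[OF p(1) k e] .
    hence "of_int k ^ e = (1 + of_nat p * of_int j :: complex)"
      by (metis of_int_1 of_int_add of_int_mult of_int_of_nat_eq of_int_power)
    hence "of_int k ^ e - 1 = \<pi> * (c * of_int j)" by (simp add: pc)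
    thus ?thesis using A.mult[OF cA A.of_int_mem] unfolding A.cong_mod_def by blast
  qed
  have frobS: "A.cong_mod \<pi> (z ^ q) z" if "z \<in> S" for z
  proof -
    consider "z = \<zeta>" | "z = \<beta>" | "z = \<pi>" | s where "z = inverse (of_nat s)" "\<not> p dvd s"
      using \<open>z \<in> S\<close> by (auto simp: S_def)
    thus ?thesis
    proof cases
      case 1
      have "m dvd q - 1" using q(2) by (rule dvd_mult_left)
      then obtain j where "q - 1 = m * j" by blast
      hence "z ^ q = z" using \<zeta> 1 by (simp add: q_Suc power_mult)
      thus ?thesis by (simp add: A.cong_mod_refl)
    next
      case 2
      \<comment> \<open>\<open>\<beta> ^ (q - 1)\<close> is a power of \<open>u\<close> whose
        exponent is a multiple of \<open>p - 1\<close>, hence congruent to 1.\<close>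
      have "g * (p - 1) dvd q - 1" using q(2) m(2) by (meson dvd_trans mult_dvd_mono dvd_refl)
      then obtain j where j: "q - 1 = g * ((p - 1) * j)" by (metis dvdE mult.assoc)
      have "A.cong_mod \<pi> (z * of_int u ^ ((p - 1) * j)) (z * 1)"
        by (intro A.cong_mod_mult A.cong_mod_refl unit_pow u A.power A.of_int_mem)
           (auto simp: 2 gen)
      moreover have "z ^ q = z * of_int u ^ ((p - 1) * j)"
        unfolding q_Suc j power_mult[of z] by (simp add: 2 \<beta>)
      ultimately show ?thesis by simp
    next
      case 3
      have "z ^ q - z = \<pi> * (\<pi> ^ (q - 1) - 1)" by (simp add: q_Suc 3 algebra_simps)
      moreover have "\<pi> ^ (q - 1) - 1 \<in> A" by (intro A.diff A.power gen A.one)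
      ultimately show ?thesis by (auto simp: A.cong_mod_def)
    next
      case 4
      have zA: "z \<in> A" using that by (rule SA)
      have "(p - 1) dvd q - 1" using q(2) by (rule dvd_mult_right)
      hence "A.cong_mod \<pi> (of_int (int s) ^ (q - 1)) 1" using 4 by (intro unit_pow) simp_all
      hence "A.cong_mod \<pi> (of_nat s ^ (q - 1)) 1" by simp
      \<comment> \<open>For \<open>z = 1/s\<close> the congruence for \<open>s ^ (q - 1)\<close> is
        multiplied by \<open>z ^ q\<close>; the left side collapses to \<open>z\<close>.\<close>
      hence "A.cong_mod \<pi> (z ^ q * of_nat s ^ (q - 1)) (z ^ q * 1)"
        by (intro A.cong_mod_mult A.cong_mod_refl) (auto intro: A.power A.of_nat_mem zA)
      moreover have "z ^ q * of_nat s ^ (q - 1) = z"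
      proof -
        have "(of_nat s :: complex) \<noteq> 0" using 4(2) by (metis dvd_0_right of_nat_eq_0_iff)
        thus ?thesis unfolding q_Suc 4(1) by (simp add: power_inverse)
      qed
      ultimately have "A.cong_mod \<pi> z (z ^ q)" by simp
      thus ?thesis by (rule A.cong_mod_sym)
    qed
  qed
  have frob: "A.cong_mod \<pi> (z ^ q) z" if "z \<in> A" for z
    using generated_subring_frobenius[of p S \<pi> f z] p(1) pdvd frobS that
    unfolding q_def A_def by blast
  have denom: "\<exists>s. \<not> int p dvd s \<and> algebraic_int (of_int s * z)" if "z \<in> A" for z
  proof -
    \<comment> \<open>The numbers that become integral after multiplication by an integer prime to
      \<open>p\<close> form a ring containing the generators of \<open>A\<close>.\<close>
    define L where "L = {z :: complex. \<exists>s. \<not> int p dvd s \<and> algebraic_int (of_int s * z)}"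
    have prime: "\<not> int p dvd s * t" if "\<not> int p dvd s" "\<not> int p dvd t" for s t
      using that p(1) by (simp add: prime_dvd_mult_iff)
    have p1: "\<not> int p dvd 1" using p(1) by auto
    have intL: "z \<in> L" if "algebraic_int z" for z
      unfolding L_def using p1 that by (intro CollectI exI[of _ 1]) simp
    have L: "complex_subring L"
    proof
      show "1 \<in> L" by (rule intL) simp
    next
      fix z assume "z \<in> L"
      thus "- z \<in> L" by (auto simp: L_def)
    next
      fix z z' assume "z \<in> L" "z' \<in> L"
      then obtain s s' where s: "\<not> int p dvd s" "algebraic_int (of_int s * z)"
        "\<not> int p dvd s'" "algebraic_int (of_int s' * z')" by (auto simp: L_def)
      have "algebraic_int (of_int s' * (of_int s * z) + of_int s * (of_int s' * z'))"
        by (intro algebraic_int_add algebraic_int_mult s) simp_all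
      hence "algebraic_int (of_int (s * s') * (z + z'))" by (simp add: algebra_simps)
      thus "z + z' \<in> L" using prime[OF s(1,3)] unfolding L_def by blast
      have "algebraic_int ((of_int s * z) * (of_int s' * z'))"
        by (intro algebraic_int_mult s)
      hence "algebraic_int (of_int (s * s') * (z * z'))" by (simp add: algebra_simps)
      thus "z * z' \<in> L" using prime[OF s(1,3)] unfolding L_def by blast
    qed
    have "inverse (of_nat s) \<in> L" if "\<not> p dvd s" for s
    proof -
      have "s \<noteq> 0" using that by (metis dvd_0_right)
      thus ?thesis unfolding L_def using that by (intro CollectI exI[of _ "int s"]) simp
    qed
    hence "S \<subseteq> L" using integral intL by (auto simp: S_def)
    hence "A \<subseteq> L" unfolding A_def by (rule generated_subring_least[OF L])
    thus ?thesis using that by (auto simp: L_def)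
  qed
  have AK: "A \<subseteq> K"
  proof -
    have "\<zeta> \<in> K" unfolding K_def by (rule rat_adjoin_incl) simp
    moreover have "inverse (of_nat s) \<in> K" for s
      using rat_adjoin_inverse[OF K.of_nat_mem[unfolded K_def]] by (simp add: K_def)
    ultimately have "S \<subseteq> K" using mem by (auto simp: S_def)
    thus ?thesis unfolding A_def by (rule generated_subring_least[OF K.complex_subring_axioms])
  qed
  have inv_loc: "\<exists>N. \<pi> ^ N * inverse (of_int k) \<in> A" if k: "k \<noteq> 0" for k :: int
  proof -
    have "\<not> is_unit (int p)" using p(1) by auto
    then obtain l e where l: "\<not> int p dvd l" "k = int p ^ e * l"
      using multiplicity_decompose'[OF k] by metis
    \<comment> \<open>Write \<open>k\<close> as \<open>p ^ e * l\<close>. As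
      \<open>\<pi> ^ (n * e) = p ^ e * \<beta> ^ (x * e)\<close>, the powers of \<open>p\<close>
      cancel and only the denominator \<open>l\<close>, invertible in \<open>A\<close>,
      remains.\<close>
    have "\<pi> ^ (n * e) * inverse (of_int k) = \<beta> ^ (x * e) * inverse (of_int l)"
      using p0 unfolding l(2) power_mult \<pi>
      by (simp add: power_mult_distrib power_mult[symmetric])
    moreover have "\<beta> ^ (x * e) * inverse (of_int l) \<in> A"
      by (intro A.mult A.power gen inv_int l)
    ultimately show ?thesis by metis
  qed
  have integers: "z \<in> A" if z: "z \<in> carrier K.R" for z
  proof -
    have zK: "z \<in> rat_adjoin {\<zeta>, \<alpha>}" and z_int: "algebraic_int z"
      using z unfolding K.carrier_R by (auto simp: K_def)
    have "\<exists>N. \<pi> ^ N * z \<in> A"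
    proof (rule A.rat_adjoin_localisation[OF gen(3) \<pi>0 _ inv_loc _ zK])
      fix z assume "z \<in> A"
      then obtain s where "\<not> int p dvd s" "algebraic_int (of_int s * z)" using denom by blast
      thus "\<exists>s::int. s \<noteq> 0 \<and> algebraic_int (of_int s * z)" by (metis dvd_0_right)
    next
      fix z assume "z \<in> {\<zeta>, \<alpha>}"
      hence "\<pi> ^ 0 * z \<in> A" using gen \<alpha>A by auto
      thus "\<exists>N. \<pi> ^ N * z \<in> A" by blast
    qed
    then obtain N where "\<pi> ^ N * z \<in> A" by blast
    thus ?thesis
      using A.mem_if_power_multiple_mem[of \<pi> q z N] frob q(1) gen(3) \<pi>0 integral(3) z_int
      by blast
  qed
  have \<beta>R: "\<beta> \<in> carrier K.R" and \<pi>R: "\<pi> \<in> carrier K.R"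
    using mem integral by (simp_all add: K.carrier_R)
  \<comment> \<open>The cofactor \<open>\<beta> ^ ((g - 1) * x)\<close> plays the part of
    \<open>\<delta>\<close>: it completes \<open>\<beta> ^ x\<close> to
    \<open>\<beta> ^ (g * x) = u ^ x\<close>.\<close>
  have \<gamma>: "\<beta> ^ x * \<beta> ^ ((g - 1) * x) = of_int (u ^ x)"
  proof -
    have "\<beta> ^ x * \<beta> ^ ((g - 1) * x) = (\<beta> * \<beta> ^ (g - 1)) ^ x"
      by (simp add: power_mult power_mult_distrib)
    also have "\<beta> * \<beta> ^ (g - 1) = of_int u" using g \<beta> by (metis Suc_diff_1 power_Suc)
    finally show ?thesis by simp
  qed
  have ux: "\<not> int p dvd u ^ x" using u p(1) by (metis prime_dvd_power prime_nat_int_transfer)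
  show ?thesis
  proof (rule K.has_ramification_indexI[OF p(1) n \<pi>R K.R_power[OF \<beta>R] K.R_power[OF \<beta>R] \<pi> \<gamma> ux])
    fix z assume z: "z \<in> carrier K.R"
    have zA: "z \<in> A" using integers[OF z] .
    obtain t where t: "t \<in> A" "z ^ q - z = \<pi> * t" using frob[OF zA] by (auto simp: A.cong_mod_def)
    \<comment> \<open>The quotient \<open>t\<close> lies only in \<open>A\<close>; the denominator
      \<open>s\<close> prime to \<open>p\<close> brings it into the ring of integers of
      \<open>K\<close>.\<close>
    obtain s where s: "\<not> int p dvd s" "algebraic_int (of_int s * t)" using denom[OF t(1)] by blast
    have "of_int s * t \<in> carrier K.R"
      using s t AK by (auto simp: K.carrier_R intro!: K.mult K.of_int_mem)
    moreover have "of_int s * (z ^ q - z) = \<pi> * (of_int s * t)" by (simp add: t)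
    ultimately show "\<exists>q s t. q > 1 \<and> \<not> int p dvd s \<and> t \<in> carrier K.R \<and>
        of_int s * (z ^ q - z) = \<pi> * t"
      using q(1) s(1) by blast
  qed
qed

section \<open>Explicit unit and uniformiser for the radical extension\<close>

theorem theorem4p3:
  fixes m p :: nat and a :: int and \<zeta> \<alpha> :: complex
  assumes "odd m" and "m > 0" and "a \<noteq> 0"
    and "primitive_root_of_unity m \<zeta>" and "\<alpha> ^ m = of_int a"
    and "\<And>q::nat. prime q \<Longrightarrow> q dvd m \<Longrightarrow> \<not> is_nth_power q (of_int a :: rat)"
    and "\<And>q::nat. prime q \<Longrightarrow> q dvd m \<Longrightarrow>
           \<not> q dvd multiplicity (int q) a \<or> q ^ multiplicity q m dvd multiplicity (int q) a"
    and "prime p" and "\<not> p dvd m"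
  shows "has_ramification_index (rat_adjoin {\<zeta>, \<alpha>}) p (m div gcd m (multiplicity (int p) a))
         \<and> tamely_ramified (rat_adjoin {\<zeta>, \<alpha>}) p"
proof -
  define K where "K = rat_adjoin {\<zeta>, \<alpha>}"
  interpret K: complex_subring K unfolding K_def by (rule complex_subring_rat_adjoin)
  define v where "v = multiplicity (int p) a"
  define g where "g = gcd m v"
  define n where "n = m div g"
  define w where "w = v div g"
  have g: "g > 0" "g dvd m" using \<open>m > 0\<close> by (simp_all add: g_def)
  have m: "m = n * g" and v: "v = w * g" by (simp_all add: n_def w_def g_def)
  have n: "n > 0" using \<open>m > 0\<close> m by (auto intro: Nat.gr0I)
  have "coprime w n"
    using div_gcd_coprime[of m v] \<open>m > 0\<close> by (simp add: n_def w_def g_def coprime_commute)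
  then obtain x where "[w * x = Suc 0] (mod n)" using cong_solve_coprime_nat by blast
  \<comment> \<open>Adding \<open>n\<close> keeps the left side at least 1, even if
    \<open>w * x = 0\<close>, so that \<open>y\<close> can be a natural number.\<close>
  hence "[w * x + n = 1] (mod n)" by (simp add: cong_def)
  hence "n dvd w * x + n - 1" using n by (intro cong_to_1_nat)
  then obtain y where "w * x + n - 1 = n * y" by blast
  hence xy: "w * x + n = 1 + n * y" using n by linarith
  have "\<not> is_unit (int p)" using \<open>prime p\<close> by auto
  then obtain u where u: "\<not> int p dvd u" "a = int p ^ v * u"
    using multiplicity_decompose'[OF \<open>a \<noteq> 0\<close>] unfolding v_def by metis
  have p0: "(of_nat p :: complex) \<noteq> 0" using \<open>prime p\<close> by auto
  \<comment> \<open>Normalise valuations over \<open>p\<close> so that \<open>p\<close> has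
    valuation 1. Then \<open>\<alpha>\<close> has valuation \<open>w / n\<close>, so
    \<open>\<beta>\<close> has valuation 0 and \<open>\<pi>\<close> has valuation
    \<open>(w * x + n - n * y) / n = 1 / n\<close>.\<close>
  define \<beta> where "\<beta> = \<alpha> ^ n / of_nat p ^ w"
  define \<pi> where "\<pi> = \<alpha> ^ x * of_nat p / of_nat p ^ y"
  have \<alpha>n: "\<alpha> ^ n = \<beta> * of_nat p ^ w" using p0 by (simp add: \<beta>_def)
  have \<beta>: "\<beta> ^ g = of_int u"
    using p0 \<open>\<alpha> ^ m = of_int a\<close> unfolding \<beta>_def power_divide
    by (simp add: power_mult[symmetric] m[symmetric] v[symmetric] u(2))
  have \<pi>: "\<pi> ^ n = of_nat p * \<beta> ^ x"
  proof -
    have "\<pi> ^ n * of_nat p ^ (n * y) = (\<alpha> ^ n) ^ x * of_nat p ^ n"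
      using p0 by (simp add: \<pi>_def power_divide power_mult_distrib power_mult[symmetric] mult_ac)
    also have "\<dots> = \<beta> ^ x * of_nat p ^ (w * x + n)"
      by (simp add: \<alpha>n power_mult_distrib power_mult[symmetric] power_add)
    also have "\<dots> = of_nat p * \<beta> ^ x * of_nat p ^ (n * y)"
      unfolding xy by simp
    finally show ?thesis using p0 by simp
  qed
  \<comment> \<open>Both sides come from the same power of \<open>\<alpha>\<close>, with exponent
    \<open>1 + n * y = w * x + n\<close>, after cancelling \<open>p ^ (w * y)\<close>. The relation
    recovers \<open>\<alpha>\<close> from \<open>\<pi>\<close> and the unit
    \<open>\<beta>\<close>.\<close>
  have \<alpha>: "\<alpha> * \<beta> ^ y = \<pi> ^ w * \<beta>"
  proof -
    have "\<alpha> * \<beta> ^ y * of_nat p ^ (w * y) = \<alpha> * (\<alpha> ^ n) ^ y"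
      by (simp add: \<alpha>n power_mult_distrib power_mult)
    also have "\<dots> = \<alpha> ^ (w * x + n)" unfolding xy by (simp add: power_mult)
    also have "\<dots> = \<alpha> ^ (w * x) * \<beta> * of_nat p ^ w" by (simp add: power_add \<alpha>n)
    also have "\<dots> = \<pi> ^ w * \<beta> * of_nat p ^ (w * y)"
      using p0 by (simp add: \<pi>_def power_divide power_mult_distrib power_mult[symmetric] mult_ac)
    finally show ?thesis using p0 by simp
  qed
  have \<alpha>K: "\<alpha> \<in> K" unfolding K_def by (rule rat_adjoin_incl) simp
  have mem: "\<beta> \<in> K" "\<pi> \<in> K"
    unfolding \<beta>_def \<pi>_def K_def
    by (intro rat_adjoin_divide; fold K_def; intro K.mult K.power K.of_nat_mem \<alpha>K)+
  have "\<zeta> ^ m = 1" using \<open>primitive_root_of_unity m \<zeta>\<close> by (simp add: primitive_root_of_unity_def)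
  hence ram: "has_ramification_index K p n"
    using has_ramification_index_rat_adjoin[of p m g n \<zeta> \<beta> u \<pi> x \<alpha> y w]
      \<open>prime p\<close> \<open>\<not> p dvd m\<close> \<open>m > 0\<close> g n \<beta> u(1) \<pi> \<alpha> mem by (simp add: K_def)
  have "\<not> p dvd n" using \<open>\<not> p dvd m\<close> m by auto
  hence "tamely_ramified K p"
    using ram unfolding tamely_ramified_def has_ramification_index_def
    by (metis imageI singletonD)
  thus ?thesis using ram by (simp add: K_def n_def g_def v_def)
qed

end
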